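(* Let $X$ be a simplicial set. The canonical projection $C_*X\to C^{\mathrm{ND}}_*X$ from the non-normalized chain complex of $X$ to its normalized chain complex is a homology equivalence.
   Context: For a simplicial set $X$ with $p$-simplices $X_p$, the non-normalized chain complex $C_*X$ has $C_pX=\mathbb Z[X_p]$ with differential $d\sigma=\sum_{i=0}^p(-1)^i\partial_i\sigma$. A $p$-simplex is degenerate if it is of the form $\alpha^*\tau$ for some $\tau\in X_q$ with $q<p$ and some increasing (i.e. order-preserving) map $\alpha:[0\ldots p]\to[0\ldots q]$. The degenerate simplices generate a subcomplex $C^{\mathrm{D}}_*X\subset C_*X$, and the normalized chain complex is the quotient $C^{\mathrm{ND}}_*X=C_*X/C^{\mathrm{D}}_*X$; it is free on the non-degenerate simplices, with the same boundary formula where degenerate faces are cancelled. A homology equivalence is a chain map inducing isomorphisms on all homology groups. *)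

theory Defs
  imports "HOL-Algebra.Free_Abelian_Groups"
begin

section \<open>Chain complexes and homology\<close>

text \<open>Complexes are concentrated in degrees \<open>\<ge> 0\<close>. The differential leaving degree \<open>p + 1\<close> is
  \<^term>\<open>d p\<close>; everything in degree 0 is a cycle.\<close>

locale chain_complex =
  fixes C :: "nat \<Rightarrow> ('c, 'm) monoid_scheme"
    and d :: "nat \<Rightarrow> 'c \<Rightarrow> 'c"
  assumes comm_group_C: "comm_group (C p)"
    and d_hom: "d p \<in> hom (C (Suc p)) (C p)"
    and d_d: "x \<in> carrier (C (Suc (Suc p))) \<Longrightarrow> d p (d (Suc p) x) = \<one>\<^bsub>C p\<^esub>"

definition cycles :: "(nat \<Rightarrow> ('c, 'm) monoid_scheme) \<Rightarrow> (nat \<Rightarrow> 'c \<Rightarrow> 'c) \<Rightarrow> nat \<Rightarrow> 'c set"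
  where "cycles C d p =
    (case p of 0 \<Rightarrow> carrier (C 0) | Suc q \<Rightarrow> kernel (C (Suc q)) (C q) (d q))"

definition boundaries :: "(nat \<Rightarrow> ('c, 'm) monoid_scheme) \<Rightarrow> (nat \<Rightarrow> 'c \<Rightarrow> 'c) \<Rightarrow> nat \<Rightarrow> 'c set"
  where "boundaries C d p = d p ` carrier (C (Suc p))"

definition homology :: "(nat \<Rightarrow> ('c, 'm) monoid_scheme) \<Rightarrow> (nat \<Rightarrow> 'c \<Rightarrow> 'c) \<Rightarrow> nat \<Rightarrow> 'c set monoid"
  where "homology C d p = subgroup_generated (C p) (cycles C d p) Mod boundaries C d p"

text \<open>The map between cosets induced by \<open>f\<close>, where \<open>N'\<close> is the target subgroup;
  it sends \<open>N #> x\<close> to \<open>N' #> f x\<close>, as the next lemma shows.\<close>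

definition coset_map :: "('e, 'n) monoid_scheme \<Rightarrow> 'e set \<Rightarrow> ('c \<Rightarrow> 'e) \<Rightarrow> 'c set \<Rightarrow> 'e set"
  where "coset_map G' N' f c = N' <#>\<^bsub>G'\<^esub> f ` c"

lemma coset_map_r_coset:
  assumes "group G" "group G'" "f \<in> hom G G'" "subgroup N G" "subgroup N' G'"
    and fN: "f ` N \<subseteq> N'" and x: "x \<in> carrier G"
  shows "coset_map G' N' f (N #>\<^bsub>G\<^esub> x) = N' #>\<^bsub>G'\<^esub> f x"
proof -
  interpret f: group_hom G G' f
    using assms by (simp add: group_hom_def group_hom_axioms_def)
  interpret N: subgroup N G by fact
  interpret N': subgroup N' G' by fact
  have fNc: "f ` N \<subseteq> carrier G'" using fN N'.subset by blast
  have "f ` (N #>\<^bsub>G\<^esub> x) = f ` N #>\<^bsub>G'\<^esub> f x"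
    using N.subset x by (force simp: r_coset_def)
  moreover have "N' <#>\<^bsub>G'\<^esub> f ` N = N'"
  proof (intro equalityI subsetI)
    fix y assume "y \<in> N' <#>\<^bsub>G'\<^esub> f ` N"
    then show "y \<in> N'" using fN by (auto simp: set_mult_def)
  next
    fix y assume "y \<in> N'"
    moreover have "\<one>\<^bsub>G'\<^esub> \<in> f ` N" using N.one_closed f.hom_one by (metis imageI)
    ultimately show "y \<in> N' <#>\<^bsub>G'\<^esub> f ` N"
      unfolding set_mult_def using f.H.r_one N'.subset by force
  qed
  ultimately show ?thesis
    using f.H.setmult_rcos_assoc[of N' "f ` N" "f x"] N'.subset fNc x
    by (simp add: coset_map_def)
qed

definition is_chain_map ::
    "(nat \<Rightarrow> ('c, 'm) monoid_scheme) \<Rightarrow> (nat \<Rightarrow> 'c \<Rightarrow> 'c) \<Rightarrow>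
     (nat \<Rightarrow> ('e, 'n) monoid_scheme) \<Rightarrow> (nat \<Rightarrow> 'e \<Rightarrow> 'e) \<Rightarrow> (nat \<Rightarrow> 'c \<Rightarrow> 'e) \<Rightarrow> bool"
  where "is_chain_map C d C' d' f \<longleftrightarrow>
    chain_complex C d \<and> chain_complex C' d' \<and>
    (\<forall>p. f p \<in> hom (C p) (C' p)) \<and>
    (\<forall>p. \<forall>x\<in>carrier (C (Suc p)). f p (d p x) = d' p (f (Suc p) x))"

definition homology_map ::
    "(nat \<Rightarrow> ('e, 'n) monoid_scheme) \<Rightarrow> (nat \<Rightarrow> 'e \<Rightarrow> 'e) \<Rightarrow> (nat \<Rightarrow> 'c \<Rightarrow> 'e) \<Rightarrow>
     nat \<Rightarrow> 'c set \<Rightarrow> 'e set"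
  where "homology_map C' d' f p = coset_map (C' p) (boundaries C' d' p) (f p)"

definition homology_equivalence ::
    "(nat \<Rightarrow> ('c, 'm) monoid_scheme) \<Rightarrow> (nat \<Rightarrow> 'c \<Rightarrow> 'c) \<Rightarrow>
     (nat \<Rightarrow> ('e, 'n) monoid_scheme) \<Rightarrow> (nat \<Rightarrow> 'e \<Rightarrow> 'e) \<Rightarrow> (nat \<Rightarrow> 'c \<Rightarrow> 'e) \<Rightarrow> bool"
  where "homology_equivalence C d C' d' f \<longleftrightarrow>
    is_chain_map C d C' d' f \<and>
    (\<forall>p. homology_map C' d' f p \<in> iso (homology C d p) (homology C' d' p))"


section \<open>Simplicial sets\<close>

text \<open>Order-preserving maps \<open>[0..p] \<rightarrow> [0..q]\<close>, made extensional so that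
  equal maps are equal as HOL functions.\<close>

definition monotone_maps :: "nat \<Rightarrow> nat \<Rightarrow> (nat \<Rightarrow> nat) set"
  where "monotone_maps p q = {\<alpha> \<in> {..p} \<rightarrow>\<^sub>E {..q}. mono_on {..p} \<alpha>}"

text \<open>A contravariant functor from the simplex category to sets:
  \<open>act p q \<alpha> : X q \<rightarrow> X p\<close> is \<open>\<alpha>\<^sup>*\<close> for \<open>\<alpha> : [0..p] \<rightarrow> [0..q]\<close>. The same element of
  the ambient type may represent simplices of several dimensions.\<close>

locale simplicial_set =
  fixes X :: "nat \<Rightarrow> 'a set"
    and act :: "nat \<Rightarrow> nat \<Rightarrow> (nat \<Rightarrow> nat) \<Rightarrow> 'a \<Rightarrow> 'a"
  assumes act_closed: "\<alpha> \<in> monotone_maps p q \<Longrightarrow> x \<in> X q \<Longrightarrow> act p q \<alpha> x \<in> X p"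
    and act_id: "x \<in> X p \<Longrightarrow> act p p (\<lambda>i\<in>{..p}. i) x = x"
    and act_compose:
      "\<alpha> \<in> monotone_maps p q \<Longrightarrow> \<beta> \<in> monotone_maps q r \<Longrightarrow> x \<in> X r \<Longrightarrow>
        act p r (compose {..p} \<beta> \<alpha>) x = act p q \<alpha> (act q r \<beta> x)"
begin

definition coface :: "nat \<Rightarrow> nat \<Rightarrow> nat \<Rightarrow> nat"
  \<comment> \<open>the injection \<open>[0..p] \<rightarrow> [0..p+1]\<close> that omits \<open>i\<close>\<close>
  where "coface p i = (\<lambda>j\<in>{..p}. if j < i then j else Suc j)"

definition face :: "nat \<Rightarrow> nat \<Rightarrow> 'a \<Rightarrow> 'a"
  \<comment> \<open>\<open>\<partial>\<^sub>i : X (p+1) \<rightarrow> X p\<close>\<close>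
  where "face p i = act p (Suc p) (coface p i)"

definition degenerate :: "nat \<Rightarrow> 'a set"
  where "degenerate p = {\<sigma> \<in> X p. \<exists>q<p. \<exists>\<tau>\<in>X q. \<exists>\<alpha>\<in>monotone_maps p q. \<sigma> = act p q \<alpha> \<tau>}"

definition chains :: "nat \<Rightarrow> ('a \<Rightarrow>\<^sub>0 int) monoid"
  where "chains p = free_Abelian_group (X p)"

definition boundary :: "nat \<Rightarrow> ('a \<Rightarrow>\<^sub>0 int) \<Rightarrow> ('a \<Rightarrow>\<^sub>0 int)"
  where "boundary p =
    frag_extend (\<lambda>\<sigma>. \<Sum>i\<le>Suc p. frag_cmul ((-1) ^ i) (frag_of (face p i \<sigma>)))"

definition degenerate_chains :: "nat \<Rightarrow> ('a \<Rightarrow>\<^sub>0 int) set"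
  where "degenerate_chains p = generate (chains p) (frag_of ` degenerate p)"

definition normalized_chains :: "nat \<Rightarrow> ('a \<Rightarrow>\<^sub>0 int) set monoid"
  where "normalized_chains p = chains p Mod degenerate_chains p"

definition normalized_boundary :: "nat \<Rightarrow> ('a \<Rightarrow>\<^sub>0 int) set \<Rightarrow> ('a \<Rightarrow>\<^sub>0 int) set"
  where "normalized_boundary p = coset_map (chains p) (degenerate_chains p) (boundary p)"

definition normalization :: "nat \<Rightarrow> ('a \<Rightarrow>\<^sub>0 int) \<Rightarrow> ('a \<Rightarrow>\<^sub>0 int) set"
  \<comment> \<open>the canonical projection onto the quotient\<close>
  where "normalization p c = degenerate_chains p #>\<^bsub>chains p\<^esub> c"

end

end

theory Submission
  imports Defs
begin

text \<open>
  By the long exact sequence argument, it suffices that the subcomplex of degenerate chains is acyclic.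
  It is filtered by the subcomplexes \<open>D\<^sub>k\<close> spanned by the simplices \<open>s\<^sub>i x\<close> with \<open>i < k\<close>.
  The simplicial identities show that \<open>s\<^sub>k\<close> preserves \<open>D\<^sub>k\<close> and that \<open>d s\<^sub>k + s\<^sub>k d\<close> agrees with
  \<open>(-1)^k\<close> on \<open>D\<^sub>k\<^sub>+\<^sub>1\<close> modulo \<open>D\<^sub>k\<close>. Subtracting the boundary of \<open>(-1)^k s\<^sub>k c\<close> therefore moves a cycle \<open>c\<close>
  of \<open>D\<^sub>k\<^sub>+\<^sub>1\<close> into \<open>D\<^sub>k\<close>, and after finitely many steps into \<open>D\<^sub>0 = 0\<close>.
\<close>

section \<open>Homology of quotient complexes\<close>

lemma (in group) r_coset_eq_iff:
  assumes "subgroup H G" "x \<in> carrier G" "y \<in> carrier G"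
  shows "H #> x = H #> y \<longleftrightarrow> x \<otimes> inv y \<in> H"
proof -
  interpret H: subgroup H G by fact
  have "H #> x = H #> y \<longleftrightarrow> x \<in> H #> y"
    using assms rcos_self[of x H] repr_independence[of x H y] by metis
  then show ?thesis
    using H.rcos_module[of y x] assms is_group by simp
qed

section \<open>Cycles, boundaries and homology classes as cosets\<close>

context chain_complex
begin

lemma group_C: "group (C p)"
  using comm_group_C comm_group.axioms(2) by blast

lemma group_hom_d: "group_hom (C (Suc p)) (C p) (d p)"
  by (simp add: group_hom_def group_hom_axioms_def group_C d_hom)

lemma subgroup_cycles: "subgroup (cycles C d p) (C p)"
  by (cases p)
    (simp_all add: cycles_def group.subgroup_self group_C group_hom.subgroup_kernel group_hom_d)

lemma subgroup_boundaries: "subgroup (boundaries C d p) (C p)"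
  unfolding boundaries_def by (simp add: group_hom.img_is_subgroup group_hom_d)

lemma cycles_subset: "cycles C d p \<subseteq> carrier (C p)"
  using subgroup.subset subgroup_cycles by blast

lemma boundaries_subset_cycles: "boundaries C d p \<subseteq> cycles C d p"
proof (cases p)
  case 0
  then show ?thesis
    using subgroup.subset[OF subgroup_boundaries[of 0]] by (simp add: cycles_def)
next
  case (Suc q)
  then show ?thesis
    using hom_carrier[OF d_hom[of "Suc q"]]
    by (auto simp: cycles_def boundaries_def kernel_def d_d)
qed

lemma boundaries_normal: "boundaries C d p \<lhd> C p"
  by (simp add: comm_group.normal_iff_subgroup comm_group_C subgroup_boundaries)

text \<open>The cycles already form a subgroup, so \<open>subgroup_generated\<close> adds no
  elements, and it keeps the multiplication of \<open>C p\<close>. Homology classes are therefore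
  cosets formed in \<open>C p\<close> itself, which removes the intermediate group from later
  arguments.\<close>

lemma carrier_homology:
  "carrier (homology C d p) = (\<lambda>x. boundaries C d p #>\<^bsub>C p\<^esub> x) ` cycles C d p"
  using subgroup.carrier_subgroup_generated_subgroup[OF subgroup_cycles[of p]]
  by (simp add: homology_def carrier_FactGroup r_coset_def)

lemma mult_homology:
  assumes "x \<in> carrier (C p)" "y \<in> carrier (C p)"
  shows "(boundaries C d p #>\<^bsub>C p\<^esub> x) \<otimes>\<^bsub>homology C d p\<^esub> (boundaries C d p #>\<^bsub>C p\<^esub> y)
    = boundaries C d p #>\<^bsub>C p\<^esub> (x \<otimes>\<^bsub>C p\<^esub> y)"
  using normal.rcos_sum[OF boundaries_normal assms]
  by (simp add: homology_def set_mult_def)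

end

lemma is_chain_map_cycles:
  assumes "is_chain_map C d C' d' f" and "x \<in> cycles C d p"
  shows "f p x \<in> cycles C' d' p"
proof -
  interpret C: chain_complex C d using assms by (simp add: is_chain_map_def)
  interpret C': chain_complex C' d' using assms by (simp add: is_chain_map_def)
  have f: "f p \<in> hom (C p) (C' p)" for p using assms by (simp add: is_chain_map_def)
  show ?thesis
  proof (cases p)
    case 0
    then show ?thesis using assms(2) hom_carrier[OF f] by (auto simp: cycles_def)
  next
    case (Suc q)
    then have x: "x \<in> carrier (C (Suc q))" "d q x = \<one>\<^bsub>C q\<^esub>"
      using assms(2) by (auto simp: cycles_def kernel_def)
    then have "d' q (f (Suc q) x) = \<one>\<^bsub>C' q\<^esub>"
      using assms(1) hom_one[OF f C.group_C C'.group_C] by (metis is_chain_map_def)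
    then show ?thesis
      using Suc x hom_carrier[OF f[of p]] by (auto simp: cycles_def kernel_def)
  qed
qed

lemma is_chain_map_boundaries:
  assumes "is_chain_map C d C' d' f"
  shows "f p ` boundaries C d p \<subseteq> boundaries C' d' p"
  using assms hom_carrier[of "f (Suc p)" "C (Suc p)" "C' (Suc p)"]
  by (auto simp: boundaries_def is_chain_map_def)

text \<open>Moves the question from classes to representatives. Triviality of the kernel suffices
  for injectivity because \<open>inj\<close> can be applied to the quotient of two
  representatives.\<close>

lemma homology_equivalenceI:
  assumes f: "is_chain_map C d C' d' f"
    and inj: "\<And>p x. x \<in> cycles C d p \<Longrightarrow> f p x \<in> boundaries C' d' p \<Longrightarrow> x \<in> boundaries C d p"
    and surj: "\<And>p y. y \<in> cycles C' d' p \<Longrightarrow>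
      \<exists>x\<in>cycles C d p. \<exists>b\<in>boundaries C' d' p. y = b \<otimes>\<^bsub>C' p\<^esub> f p x"
  shows "homology_equivalence C d C' d' f"
  unfolding homology_equivalence_def
proof (intro conjI allI)
  show "is_chain_map C d C' d' f" by fact
  fix p
  interpret C: chain_complex C d using f by (simp add: is_chain_map_def)
  interpret C': chain_complex C' d' using f by (simp add: is_chain_map_def)
  interpret f: group_hom "C p" "C' p" "f p"
    using f by (simp add: is_chain_map_def group_hom_def group_hom_axioms_def C.group_C C'.group_C)
  let ?B = "boundaries C d p" and ?B' = "boundaries C' d' p"
  let ?H = "homology_map C' d' f p"
  have H: "?H (?B #>\<^bsub>C p\<^esub> x) = ?B' #>\<^bsub>C' p\<^esub> f p x" if "x \<in> cycles C d p" for x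
    unfolding homology_map_def
    using that C.cycles_subset is_chain_map_boundaries[OF f]
    by (intro coset_map_r_coset) (auto simp: C.group_C C'.group_C f.homh
        C.subgroup_boundaries C'.subgroup_boundaries)
  show "?H \<in> iso (homology C d p) (homology C' d' p)"
    unfolding iso_iff
  proof (intro conjI homI)
    fix c assume "c \<in> carrier (homology C d p)"
    then show "?H c \<in> carrier (homology C' d' p)"
      using is_chain_map_cycles[OF f] by (auto simp: C.carrier_homology C'.carrier_homology H)
  next
    fix c c' assume "c \<in> carrier (homology C d p)" "c' \<in> carrier (homology C d p)"
    then obtain x x' where x: "x \<in> cycles C d p" "c = ?B #>\<^bsub>C p\<^esub> x"
      and x': "x' \<in> cycles C d p" "c' = ?B #>\<^bsub>C p\<^esub> x'"
      by (auto simp: C.carrier_homology)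
    have "x \<otimes>\<^bsub>C p\<^esub> x' \<in> cycles C d p"
      using x x' C.subgroup_cycles subgroup.m_closed by metis
    moreover have "x \<in> carrier (C p)" "x' \<in> carrier (C p)"
      using x x' C.cycles_subset by auto
    ultimately show "?H (c \<otimes>\<^bsub>homology C d p\<^esub> c') = ?H c \<otimes>\<^bsub>homology C' d' p\<^esub> ?H c'"
      by (simp add: x x' C.mult_homology C'.mult_homology H)
  next
    show "inj_on ?H (carrier (homology C d p))"
    proof (rule inj_onI)
      fix c c' assume "c \<in> carrier (homology C d p)" "c' \<in> carrier (homology C d p)"
      then obtain x x' where x: "x \<in> cycles C d p" "c = ?B #>\<^bsub>C p\<^esub> x"
        and x': "x' \<in> cycles C d p" "c' = ?B #>\<^bsub>C p\<^esub> x'"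
        by (auto simp: C.carrier_homology)
      have car: "x \<in> carrier (C p)" "x' \<in> carrier (C p)"
        using x x' C.cycles_subset by auto
      have z: "x \<otimes>\<^bsub>C p\<^esub> inv\<^bsub>C p\<^esub> x' \<in> cycles C d p"
        using x x' C.subgroup_cycles[of p] by (simp add: subgroup.m_closed subgroup.m_inv_closed)
      assume "?H c = ?H c'"
      then have "f p x \<otimes>\<^bsub>C' p\<^esub> inv\<^bsub>C' p\<^esub> f p x' \<in> ?B'"
        using f.H.r_coset_eq_iff[OF C'.subgroup_boundaries] car by (simp add: x x' H)
      then have "f p (x \<otimes>\<^bsub>C p\<^esub> inv\<^bsub>C p\<^esub> x') \<in> ?B'"
        using car by simp
      then have "x \<otimes>\<^bsub>C p\<^esub> inv\<^bsub>C p\<^esub> x' \<in> ?B"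
        using inj z by blast
      then show "c = c'"
        using f.G.r_coset_eq_iff[OF C.subgroup_boundaries] car by (simp add: x x')
    qed
  next
    show "?H ` carrier (homology C d p) = carrier (homology C' d' p)"
    proof (intro equalityI subsetI)
      fix c assume "c \<in> ?H ` carrier (homology C d p)"
      then show "c \<in> carrier (homology C' d' p)"
        using is_chain_map_cycles[OF f] by (auto simp: C.carrier_homology C'.carrier_homology H)
    next
      fix c assume "c \<in> carrier (homology C' d' p)"
      then obtain y where y: "y \<in> cycles C' d' p" "c = ?B' #>\<^bsub>C' p\<^esub> y"
        by (auto simp: C'.carrier_homology)
      obtain x b where xb: "x \<in> cycles C d p" "b \<in> ?B'" "y = b \<otimes>\<^bsub>C' p\<^esub> f p x"
        using surj[OF y(1)] by blast
      have "f p x \<in> carrier (C' p)" "y \<in> carrier (C' p)" "b \<in> carrier (C' p)"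
        using y(1) xb C.cycles_subset C'.cycles_subset C'.boundaries_subset_cycles
        by (auto simp: subset_iff)
      then have "c = ?B' #>\<^bsub>C' p\<^esub> f p x"
        using f.H.r_coset_eq_iff[OF C'.subgroup_boundaries] xb(2)
        by (simp add: y(2) xb(3) f.H.m_assoc)
      then show "c \<in> ?H ` carrier (homology C d p)"
        using xb(1) by (auto simp: C.carrier_homology H[symmetric])
    qed
  qed
qed

section \<open>The quotient of a chain complex by a subcomplex\<close>

context chain_complex
begin

context
  fixes D :: "nat \<Rightarrow> 'c set"
  assumes D_subgroup: "subgroup (D p) (C p)"
    and d_D: "d p ` D (Suc p) \<subseteq> D p"
begin

private abbreviation "Q p \<equiv> C p Mod D p"
private abbreviation "dQ p \<equiv> coset_map (C p) (D p) (d p)"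
private abbreviation "\<pi> p x \<equiv> D p #>\<^bsub>C p\<^esub> x"

lemma D_normal: "D p \<lhd> C p"
  by (simp add: comm_group.normal_iff_subgroup comm_group_C D_subgroup)

lemma coset_map_quotient:
  assumes "x \<in> carrier (C (Suc p))"
  shows "dQ p (\<pi> (Suc p) x) = \<pi> p (d p x)"
  using assms by (intro coset_map_r_coset) (auto simp: group_C d_hom D_subgroup d_D)

lemma quotient_coset_eq_iff:
  "x \<in> carrier (C p) \<Longrightarrow> y \<in> carrier (C p) \<Longrightarrow> \<pi> p x = \<pi> p y \<longleftrightarrow> x \<otimes>\<^bsub>C p\<^esub> inv\<^bsub>C p\<^esub> y \<in> D p"
  by (rule group.r_coset_eq_iff[OF group_C D_subgroup])

lemma quotient_coset_eq_one_iff: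
  assumes "x \<in> carrier (C p)"
  shows "\<pi> p x = D p \<longleftrightarrow> x \<in> D p"
  using assms D_subgroup group_C by (metis group.coset_join1 group.coset_join2)

lemma chain_map_quotient: "is_chain_map C d Q dQ \<pi>"
proof -
  have car: "d p x \<in> carrier (C p)" if "x \<in> carrier (C (Suc p))" for p x
    using that hom_carrier[OF d_hom] by blast
  have "chain_complex Q dQ"
  proof (rule chain_complex.intro)
    fix p
    show "comm_group (Q p)"
      by (simp add: comm_group.abelian_FactGroup comm_group_C D_subgroup)
    show "dQ p \<in> hom (Q (Suc p)) (Q p)"
    proof (rule homI)
      fix c assume "c \<in> carrier (Q (Suc p))"
      then show "dQ p c \<in> carrier (Q p)"
        by (auto simp: carrier_FactGroup coset_map_quotient car)
    next
      fix c c' assume "c \<in> carrier (Q (Suc p))" "c' \<in> carrier (Q (Suc p))"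
      then obtain x x' where x: "x \<in> carrier (C (Suc p))" "c = \<pi> (Suc p) x"
        and x': "x' \<in> carrier (C (Suc p))" "c' = \<pi> (Suc p) x'"
        by (auto simp: carrier_FactGroup)
      show "dQ p (c \<otimes>\<^bsub>Q (Suc p)\<^esub> c') = dQ p c \<otimes>\<^bsub>Q p\<^esub> dQ p c'"
        using x x' monoid.m_closed[OF group.is_monoid[OF group_C]] hom_mult[OF d_hom]
        by (simp add: normal.rcos_sum[OF D_normal] coset_map_quotient car)
    qed
    fix c assume "c \<in> carrier (Q (Suc (Suc p)))"
    then obtain x where "x \<in> carrier (C (Suc (Suc p)))" "c = \<pi> (Suc (Suc p)) x"
      by (auto simp: carrier_FactGroup)
    then show "dQ p (dQ (Suc p) c) = \<one>\<^bsub>Q p\<^esub>"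
      \<comment> \<open>The unit of \<open>Q p\<close> is the set \<open>D p\<close>, so the coset
        of the unit of \<open>C p\<close> has to be identified with it.\<close>
      using subgroup.one_closed[OF D_subgroup, of p] subgroup.subset[OF D_subgroup, of p]
      by (simp add: coset_map_quotient car d_d subsetD quotient_coset_eq_one_iff[of "\<one>\<^bsub>C p\<^esub>" p])
  qed
  then show ?thesis
    using normal.r_coset_hom_Mod[OF D_normal]
    by (auto simp: is_chain_map_def coset_map_quotient chain_complex_axioms)
qed

text \<open>The diagram chase of the long exact sequence, carried out directly. Since everything in
  degree 0 is a cycle, the hypothesis also forces every element of \<open>D 0\<close> to
  bound.\<close>

lemma quotient_homology_equivalence:
  assumes acyclic: "\<And>p x. x \<in> D p \<Longrightarrow> x \<in> cycles C d p \<Longrightarrow> x \<in> d p ` D (Suc p)"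
  shows "homology_equivalence C d Q dQ \<pi>"
proof (rule homology_equivalenceI[OF chain_map_quotient])
  fix p x assume x: "x \<in> cycles C d p" "\<pi> p x \<in> boundaries Q dQ p"
  interpret G: group "C p" by (rule group_C)
  interpret d: group_hom "C (Suc p)" "C p" "d p" by (rule group_hom_d)
  interpret B: subgroup "boundaries C d p" "C p" by (rule subgroup_boundaries)
  interpret Z: subgroup "cycles C d p" "C p" by (rule subgroup_cycles)
  interpret D: subgroup "D (Suc p)" "C (Suc p)" by (rule D_subgroup)
  \<comment> \<open>A chain bounding the class of \<open>x\<close> in the quotient lifts to
    \<open>y\<close>. Then \<open>x\<close> and \<open>d p y\<close> differ by a cycle lying in
    \<open>D p\<close>, which bounds by acyclicity.\<close>
  obtain y where y: "y \<in> carrier (C (Suc p))" "\<pi> p x = \<pi> p (d p y)"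
    using x(2) by (auto simp: boundaries_def carrier_FactGroup coset_map_quotient)
  have dy: "d p y \<in> boundaries C d p" using y(1) by (simp add: boundaries_def)
  then have "d p y \<in> cycles C d p" using boundaries_subset_cycles by blast
  then have "x \<otimes>\<^bsub>C p\<^esub> inv\<^bsub>C p\<^esub> d p y \<in> cycles C d p" using x(1) by simp
  moreover have "x \<otimes>\<^bsub>C p\<^esub> inv\<^bsub>C p\<^esub> d p y \<in> D p"
    using quotient_coset_eq_iff[of x p "d p y"] x(1) y by simp
  ultimately have "x \<otimes>\<^bsub>C p\<^esub> inv\<^bsub>C p\<^esub> d p y \<in> boundaries C d p"
    using acyclic unfolding boundaries_def by fastforce
  then have "(x \<otimes>\<^bsub>C p\<^esub> inv\<^bsub>C p\<^esub> d p y) \<otimes>\<^bsub>C p\<^esub> d p y \<in> boundaries C d p"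
    using dy by simp
  then show "x \<in> boundaries C d p"
    using x(1) y(1) by (simp add: G.m_assoc)
next
  fix p c assume c: "c \<in> cycles Q dQ p"
  interpret Q: chain_complex Q dQ using chain_map_quotient by (simp add: is_chain_map_def)
  interpret Q: group "Q p" by (rule Q.group_C)
  have "\<exists>x\<in>cycles C d p. c = \<pi> p x"
  proof (cases p)
    case 0
    then show ?thesis using c by (auto simp: cycles_def carrier_FactGroup)
  next
    case (Suc q)
    interpret G: group "C (Suc q)" by (rule group_C)
    interpret d: group_hom "C (Suc q)" "C q" "d q" by (rule group_hom_d)
    interpret D: subgroup "D (Suc q)" "C (Suc q)" by (rule D_subgroup)
    obtain x where x: "x \<in> carrier (C (Suc q))" "c = \<pi> (Suc q) x" "\<pi> q (d q x) = D q"
      using c Suc by (auto simp: cycles_def kernel_def carrier_FactGroup coset_map_quotient)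
    \<comment> \<open>The lift \<open>x\<close> need not be a cycle, but its differential is a cycle
      lying in \<open>D q\<close>, so acyclicity one degree lower applies to it.\<close>
    have "d q x \<in> D q" using quotient_coset_eq_one_iff x by simp
    moreover have "d q x \<in> cycles C d q"
      using x(1) boundaries_subset_cycles[of q] by (auto simp: boundaries_def)
    ultimately obtain e where e: "e \<in> D (Suc q)" "d q x = d q e"
      using acyclic by blast
    \<comment> \<open>Dividing by \<open>e\<close> kills the differential and stays in the same
      coset, because \<open>e\<close> lies in \<open>D (Suc q)\<close>.\<close>
    let ?x = "inv\<^bsub>C (Suc q)\<^esub> e \<otimes>\<^bsub>C (Suc q)\<^esub> x"
    have "?x \<in> cycles C d p" using x(1) e Suc by (simp add: cycles_def kernel_def)
    moreover have "\<pi> (Suc q) x = \<pi> (Suc q) ?x"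
      using x(1) e(1) quotient_coset_eq_iff[of x "Suc q" ?x]
      by (simp add: G.inv_mult_group flip: G.m_assoc)
    ultimately show ?thesis using x(2) Suc by blast
  qed
  then obtain x where x: "x \<in> cycles C d p" "c = \<pi> p x" by blast
  \<comment> \<open>The class is hit exactly, so the boundary correction allowed by the criterion is
    the unit.\<close>
  have "\<one>\<^bsub>Q p\<^esub> \<in> boundaries Q dQ p" by (rule subgroup.one_closed[OF Q.subgroup_boundaries])
  moreover have "c = \<one>\<^bsub>Q p\<^esub> \<otimes>\<^bsub>Q p\<^esub> \<pi> p x"
    using subsetD[OF Q.cycles_subset c] unfolding x(2) by (rule Q.l_one[symmetric])
  ultimately show "\<exists>x\<in>cycles C d p. \<exists>b\<in>boundaries Q dQ p. c = b \<otimes>\<^bsub>Q p\<^esub> \<pi> p x"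
    using x(1) by blast
qed

end

end

section \<open>Chains in free abelian groups\<close>

text \<open>Shaped for the faces of a degeneracy of index \<open>k\<close>: faces \<open>k\<close>
  and \<open>k + 1\<close> will cancel, and the indices above them are shifted down by one as in
  \<open>face_degeneracy_above\<close>.\<close>

lemma sum_atMost_split_two:
  fixes f :: "nat \<Rightarrow> 'b::comm_monoid_add"
  assumes "k \<le> n"
  shows "(\<Sum>j\<le>Suc n. f j) = (\<Sum>j<k. f j) + f k + f (Suc k) + (\<Sum>j\<in>{k<..n}. f (Suc j))"
proof -
  have "{..Suc n} = {..<k} \<union> {k} \<union> {Suc k} \<union> Suc ` {k<..n}"
  proof -
    have "Suc ` {k<..n} = {Suc k<..Suc n}"
      by (simp flip: atLeastSucAtMost_greaterThanAtMost)
    then show ?thesis using assms by auto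
  qed
  moreover have "sum f (Suc ` {k<..n}) = (\<Sum>j\<in>{k<..n}. f (Suc j))"
    by (simp add: sum.reindex)
  moreover have "sum f ({..<k} \<union> {k} \<union> {Suc k} \<union> Suc ` {k<..n})
      = sum f {..<k} + sum f {k} + sum f {Suc k} + sum f (Suc ` {k<..n})"
    by (subst sum.union_disjoint; auto simp: add.commute add.left_commute)+
  ultimately show ?thesis by simp
qed

lemma keys_frag_extend_subset:
  assumes "\<And>x. x \<in> Poly_Mapping.keys c \<Longrightarrow> Poly_Mapping.keys (f x) \<subseteq> A"
  shows "Poly_Mapping.keys (frag_extend f c) \<subseteq> A"
  using keys_frag_extend[of f c] assms by blast

lemma keys_frag_sum_subset:
  assumes "\<And>j. j \<in> I \<Longrightarrow> x j \<in> A"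
  shows "Poly_Mapping.keys (\<Sum>j\<in>I. frag_cmul (c j) (frag_of (x j))) \<subseteq> A"
proof -
  have "Poly_Mapping.keys (frag_cmul (c j) (frag_of (x j))) \<subseteq> A" if "j \<in> I" for j
    using assms[OF that] by (auto simp flip: not_in_keys_iff_lookup_eq_zero)
  then show ?thesis
    using keys_sum[of "\<lambda>j. frag_cmul (c j) (frag_of (x j))" I] by blast
qed

lemma keys_add_subset:
  "Poly_Mapping.keys a \<subseteq> A \<Longrightarrow> Poly_Mapping.keys b \<subseteq> A \<Longrightarrow> Poly_Mapping.keys (a + b) \<subseteq> A"
  using keys_add[of a b] by blast

lemma keys_diff_subset:
  "Poly_Mapping.keys a \<subseteq> A \<Longrightarrow> Poly_Mapping.keys b \<subseteq> A \<Longrightarrow> Poly_Mapping.keys (a - b) \<subseteq> A"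
  using keys_diff[of a b] by blast

lemma keys_cmul_subset:
  "Poly_Mapping.keys a \<subseteq> A \<Longrightarrow> Poly_Mapping.keys (frag_cmul c a) \<subseteq> A"
  using keys_cmul[of c a] by blast

lemma frag_cmul_diff: "frag_cmul m (a - b) = frag_cmul m a - frag_cmul m b"
  by (rule poly_mapping_eqI) (simp add: lookup_minus right_diff_distrib)

lemma subgroup_free_Abelian_group:
  assumes "S \<subseteq> T"
  shows "subgroup {c. Poly_Mapping.keys c \<subseteq> S} (free_Abelian_group T)"
  using assms by unfold_locales (auto simp: keys_add_subset)

text \<open>Turns membership in a subgroup generated by basis elements into a condition on supports,
  the form used for all degenerate chains below.\<close>

lemma generate_frag_of:
  fixes S T :: "'a set"
  assumes "S \<subseteq> T"
  shows "generate (free_Abelian_group T) (frag_of ` S) = {c. Poly_Mapping.keys c \<subseteq> S}" (is "?G = _")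
proof (intro equalityI)
  show "?G \<subseteq> {c. Poly_Mapping.keys c \<subseteq> S}"
    by (rule group.generate_subgroup_incl[OF group_free_Abelian_group _
          subgroup_free_Abelian_group[OF assms]]) auto
next
  show "{c. Poly_Mapping.keys c \<subseteq> S} \<subseteq> ?G"
  proof
    fix c :: "'a \<Rightarrow>\<^sub>0 int" assume "c \<in> {c. Poly_Mapping.keys c \<subseteq> S}"
    then have "Poly_Mapping.keys c \<subseteq> S" by simp
    then show "c \<in> ?G"
    proof (induction c rule: frag_induction)
      case zero
      then show ?case using generate.one[of "free_Abelian_group T" "frag_of ` S"] by simp
    next
      case (one x)
      then show ?case by (auto intro: generate.incl)
    next
      case (diff a b)
      have sub: "frag_of ` S \<subseteq> carrier (free_Abelian_group T)"
        using assms by auto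
      then have "b \<in> carrier (free_Abelian_group T)"
        using group.generate_in_carrier[OF group_free_Abelian_group] diff(2) by blast
      then have "- b \<in> ?G"
        using group.generate_m_inv_closed[OF group_free_Abelian_group sub diff(2)] by simp
      then show ?case
        using generate.eng[OF diff(1)] by fastforce
    qed
  qed
qed

section \<open>Faces and degeneracies\<close>

context simplicial_set
begin

text \<open>Reduces each simplicial identity to a pointwise computation:
  \<open>compose {..p}\<close> is extensional, so agreement on \<open>{..p}\<close> makes the two
  composites equal functions, and functoriality does the rest.\<close>

lemma act_act_cong:
  assumes "\<alpha> \<in> monotone_maps p q" "\<beta> \<in> monotone_maps q r"
    and "\<alpha>' \<in> monotone_maps p q'" "\<beta>' \<in> monotone_maps q' r"
    and "\<And>j. j \<le> p \<Longrightarrow> \<beta> (\<alpha> j) = \<beta>' (\<alpha>' j)" and "x \<in> X r"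
  shows "act p q \<alpha> (act q r \<beta> x) = act p q' \<alpha>' (act q' r \<beta>' x)"
proof -
  have "compose {..p} \<beta> \<alpha> = compose {..p} \<beta>' \<alpha>'"
    using assms(5) by (auto simp: compose_def)
  then show ?thesis
    using act_compose[OF assms(1,2,6)] act_compose[OF assms(3,4,6)] by simp
qed

lemma act_act_id:
  assumes "\<alpha> \<in> monotone_maps p q" "\<beta> \<in> monotone_maps q p"
    and "\<And>j. j \<le> p \<Longrightarrow> \<beta> (\<alpha> j) = j" and "x \<in> X p"
  shows "act p q \<alpha> (act q p \<beta> x) = x"
proof -
  have "compose {..p} \<beta> \<alpha> = (\<lambda>i\<in>{..p}. i)"
    using assms(3) by (auto simp: compose_def)
  then show ?thesis
    using act_compose[OF assms(1,2,4)] act_id[OF assms(4)] by simp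
qed

text \<open>For \<open>i \<le> p\<close>, the order-preserving surjection from
  \<open>[0..p+1]\<close> onto \<open>[0..p]\<close> that takes the value \<open>i\<close> at both
  \<open>i\<close> and \<open>i + 1\<close>.\<close>

definition codegeneracy :: "nat \<Rightarrow> nat \<Rightarrow> nat \<Rightarrow> nat"
  where "codegeneracy p i = (\<lambda>j\<in>{..Suc p}. if j \<le> i then j else j - 1)"

definition degeneracy :: "nat \<Rightarrow> nat \<Rightarrow> 'a \<Rightarrow> 'a"
  where "degeneracy p i = act (Suc p) p (codegeneracy p i)"

lemma coface_monotone: "coface p i \<in> monotone_maps p (Suc p)"
  by (auto simp: monotone_maps_def coface_def intro!: mono_onI)

lemma codegeneracy_monotone: "i \<le> p \<Longrightarrow> codegeneracy p i \<in> monotone_maps (Suc p) p"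
  by (auto simp: monotone_maps_def codegeneracy_def intro!: mono_onI)

lemma face_closed: "x \<in> X (Suc p) \<Longrightarrow> face p i x \<in> X p"
  unfolding face_def by (rule act_closed[OF coface_monotone])

lemma degeneracy_closed: "i \<le> p \<Longrightarrow> x \<in> X p \<Longrightarrow> degeneracy p i x \<in> X (Suc p)"
  unfolding degeneracy_def by (rule act_closed[OF codegeneracy_monotone])

section \<open>The simplicial identities, with the larger index written as a successor to avoid
  truncated subtraction\<close>

lemma face_face:
  assumes "i \<le> j" "x \<in> X (Suc (Suc p))"
  shows "face p i (face (Suc p) (Suc j) x) = face p j (face (Suc p) i x)"
  unfolding face_def using assms
  by (intro act_act_cong coface_monotone) (auto simp: coface_def)

lemma face_degeneracy_below:
  assumes "j \<le> i" "i \<le> p" "x \<in> X (Suc p)"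
  shows "face (Suc p) j (degeneracy (Suc p) (Suc i) x) = degeneracy p i (face p j x)"
  unfolding face_def degeneracy_def using assms
  by (intro act_act_cong coface_monotone codegeneracy_monotone)
    (auto simp: coface_def codegeneracy_def)

lemma face_degeneracy_cancel:
  assumes "j = i \<or> j = Suc i" "i \<le> p" "x \<in> X p"
  shows "face p j (degeneracy p i x) = x"
  unfolding face_def degeneracy_def using assms
  by (intro act_act_id coface_monotone codegeneracy_monotone)
    (auto simp: coface_def codegeneracy_def)

lemma face_degeneracy_above:
  assumes "i < j" "i \<le> p" "x \<in> X (Suc p)"
  shows "face (Suc p) (Suc j) (degeneracy (Suc p) i x) = degeneracy p i (face p j x)"
  unfolding face_def degeneracy_def using assms
  by (intro act_act_cong coface_monotone codegeneracy_monotone)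
    (auto simp: coface_def codegeneracy_def)

lemma degeneracy_degeneracy:
  assumes "i \<le> k" "k \<le> p" "x \<in> X p"
  shows "degeneracy (Suc p) (Suc k) (degeneracy p i x) = degeneracy (Suc p) i (degeneracy p k x)"
  unfolding degeneracy_def using assms
  by (intro act_act_cong codegeneracy_monotone) (auto simp: codegeneracy_def)

text \<open>The basis in dimension \<open>p\<close> of the filtration step \<open>D\<^sub>k\<close>.
  The bound \<open>i \<le> q\<close> keeps indices in range, so the steps are constant from
  \<open>k = p\<close> on, and dimension 0 contributes nothing.\<close>

definition degeneracies :: "nat \<Rightarrow> nat \<Rightarrow> 'a set"
  where "degeneracies k p = {degeneracy q i x |q i x. p = Suc q \<and> i < k \<and> i \<le> q \<and> x \<in> X q}"

lemma degeneraciesI: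
  "i < k \<Longrightarrow> i \<le> q \<Longrightarrow> x \<in> X q \<Longrightarrow> degeneracy q i x \<in> degeneracies k (Suc q)"
  unfolding degeneracies_def by blast

lemma degeneraciesE:
  assumes "y \<in> degeneracies k (Suc q)"
  obtains i x where "i < k" "i \<le> q" "x \<in> X q" "y = degeneracy q i x"
  using assms unfolding degeneracies_def by blast

lemma degeneracies_subset: "degeneracies k p \<subseteq> X p"
  by (auto simp: degeneracies_def degeneracy_closed)

lemma degeneracies_0: "degeneracies k 0 = {}" "degeneracies 0 p = {}"
  by (auto simp: degeneracies_def)

text \<open>An order-preserving map to a smaller ordinal repeats a value at some neighbours
  \<open>i\<close> and \<open>i + 1\<close>, hence factors through the codegeneracy of index
  \<open>i\<close>. The simplex is then the degeneracy of its own face of index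
  \<open>i + 1\<close>.\<close>

lemma degenerate_eq_degeneracies: "degenerate p = degeneracies p p"
proof (intro equalityI subsetI)
  fix y assume "y \<in> degeneracies p p"
  then show "y \<in> degenerate p"
    using codegeneracy_monotone degeneracy_closed
    by (fastforce simp: degeneracies_def degenerate_def degeneracy_def)
next
  fix y assume "y \<in> degenerate p"
  then obtain q x \<alpha> where q: "q < p" "x \<in> X q" "\<alpha> \<in> monotone_maps p q" "y = act p q \<alpha> x"
    and y: "y \<in> X p"
    by (auto simp: degenerate_def)
  from q(1) obtain r where p: "p = Suc r" by (cases p) auto
  have mono: "\<alpha> i \<le> \<alpha> j" if "i \<le> j" "j \<le> p" for i j
    using q(3) that mono_onD[of "{..p}" \<alpha> i j] by (simp add: monotone_maps_def)
  have "\<exists>i<p. \<alpha> i = \<alpha> (Suc i)"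
  proof (rule ccontr)
    assume "\<not> (\<exists>i<p. \<alpha> i = \<alpha> (Suc i))"
    \<comment> \<open>Without a repetition \<open>\<alpha>\<close> would be strictly increasing,
      which forces \<open>p \<le> \<alpha> p \<le> q\<close>.\<close>
    then have step: "\<alpha> i < \<alpha> (Suc i)" if "i < p" for i
      using mono[of i "Suc i"] that by (simp add: order_neq_le_trans)
    have "i \<le> p \<Longrightarrow> i \<le> \<alpha> i" for i
    proof (induction i)
      case (Suc i)
      then show ?case using step[of i] by simp
    qed simp
    then have "p \<le> \<alpha> p" by simp
    moreover have "\<alpha> p \<le> q" using q(3) by (auto simp: monotone_maps_def)
    ultimately show False using q(1) by simp
  qed
  then obtain i where i: "i \<le> r" "\<alpha> i = \<alpha> (Suc i)" using p less_Suc_eq_le by blast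
  \<comment> \<open>This composite sends \<open>i + 1\<close> to \<open>i\<close> and fixes all
    other points of \<open>{..p}\<close>, so precomposing \<open>\<alpha>\<close> with it changes
    nothing.\<close>
  have "act p q \<alpha> x = act p p (compose {..p} (coface r (Suc i)) (codegeneracy r i)) (act p q \<alpha> x)"
  proof -
    have "compose {..p} (coface r (Suc i)) (codegeneracy r i) \<in> monotone_maps p p"
      using i(1) by (auto simp: monotone_maps_def p compose_def coface_def codegeneracy_def
          intro!: mono_onI)
    moreover have "compose {..p} \<alpha> (compose {..p} (coface r (Suc i)) (codegeneracy r i)) = \<alpha>"
    proof
      fix j
      \<comment> \<open>The case \<open>p < j\<close> compares default values outside the
        domain.\<close>
      consider "j \<le> i" | "j = Suc i" | "Suc i < j" "j \<le> p" | "p < j" by linarith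
      then show "compose {..p} \<alpha> (compose {..p} (coface r (Suc i)) (codegeneracy r i)) j = \<alpha> j"
        using i p q(3)
        by cases (auto simp: compose_def coface_def codegeneracy_def monotone_maps_def PiE_def
            extensional_def)
    qed
    ultimately show ?thesis
      using act_compose[of _ p p \<alpha> q x] q(2,3) by metis
  qed
  also have "\<dots> = degeneracy r i (face r (Suc i) y)"
    using act_compose[OF codegeneracy_monotone[OF i(1)] coface_monotone[of r "Suc i"], of y] y
    by (simp add: q(4) p degeneracy_def face_def)
  finally show "y \<in> degeneracies p p"
    using degeneraciesI[of i p r "face r (Suc i) y"] face_closed[of y r "Suc i"] y i(1) q(4) p
    by simp
qed

section \<open>The degenerate subcomplex is acyclic\<close>

lemma boundary_frag_of:
  "boundary p (frag_of x) = (\<Sum>j\<le>Suc p. frag_cmul ((-1) ^ j) (frag_of (face p j x)))"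
  by (simp add: boundary_def)

lemma boundary_closed: "Poly_Mapping.keys c \<subseteq> X (Suc p) \<Longrightarrow> Poly_Mapping.keys (boundary p c) \<subseteq> X p"
  unfolding boundary_def
  by (intro keys_frag_extend_subset keys_frag_sum_subset face_closed) blast

lemma boundary_zero: "boundary p 0 = 0"
  and boundary_add: "boundary p (a + b) = boundary p a + boundary p b"
  and boundary_diff: "boundary p (a - b) = boundary p a - boundary p b"
  and boundary_cmul: "boundary p (frag_cmul m a) = frag_cmul m (boundary p a)"
  and boundary_sum: "finite I \<Longrightarrow> boundary p (\<Sum>i\<in>I. g i) = (\<Sum>i\<in>I. boundary p (g i))"
  by (simp_all add: boundary_def frag_extend_add frag_extend_diff frag_extend_cmul frag_extend_sum)

lemma boundary_boundary:
  assumes "Poly_Mapping.keys c \<subseteq> X (Suc (Suc p))"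
  shows "boundary p (boundary (Suc p) c) = 0"
  using assms
proof (induction c rule: frag_induction)
  case zero
  then show ?case by (simp add: boundary_zero)
next
  case (diff a b)
  then show ?case by (simp add: boundary_diff)
next
  case (one x)
  let ?f = "\<lambda>j i. frag_cmul ((-1) ^ (j + i)) (frag_of (face p i (face (Suc p) j x)))"
  let ?A = "{..Suc (Suc p)} \<times> {..Suc p}"
  \<comment> \<open>The terms with \<open>i < j\<close> are matched with the remaining ones by
    sending \<open>(i, j)\<close> to \<open>(Suc j, i)\<close>. By \<open>face_face\<close> this
    preserves the iterated face, while the sign changes.\<close>
  have below: "?A \<inter> {(j, i). i < j} = (\<lambda>(i, j). (Suc j, i)) ` {(i, j). i \<le> j \<and> j \<le> Suc p}"
  proof (intro equalityI subsetI)
    fix z assume "z \<in> ?A \<inter> {(j, i). i < j}"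
    then obtain j i where "z = (j, i)" "i < j" "j \<le> Suc (Suc p)" by auto
    then show "z \<in> (\<lambda>(i, j). (Suc j, i)) ` {(i, j). i \<le> j \<and> j \<le> Suc p}"
      by (intro image_eqI[of _ _ "(i, j - 1)"]) auto
  qed auto
  have above: "?A - {(j, i). i < j} = {(i, j). i \<le> j \<and> j \<le> Suc p}"
    by auto
  have "boundary p (boundary (Suc p) (frag_of x)) = (\<Sum>j\<le>Suc (Suc p). \<Sum>i\<le>Suc p. ?f j i)"
    unfolding boundary_frag_of
    by (simp only: boundary_sum finite_atMost boundary_cmul boundary_frag_of frag_cmul_sum
        frag_cmul_cmul power_add)
  also have "\<dots> = (\<Sum>(j, i)\<in>?A. ?f j i)"
    by (rule sum.cartesian_product)
  also have "\<dots> = (\<Sum>(j, i)\<in>?A \<inter> {(j, i). i < j}. ?f j i) + (\<Sum>(j, i)\<in>?A - {(j, i). i < j}. ?f j i)"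
    by (rule sum.Int_Diff) simp
  also have "(\<Sum>(j, i)\<in>?A \<inter> {(j, i). i < j}. ?f j i)
      = (\<Sum>(i, j)\<in>{(i, j). i \<le> j \<and> j \<le> Suc p}. ?f (Suc j) i)"
    unfolding below by (subst sum.reindex) (auto simp: inj_on_def case_prod_beta)
  also have "\<dots> = (\<Sum>(i, j)\<in>{(i, j). i \<le> j \<and> j \<le> Suc p}. - ?f i j)"
    using one by (intro sum.cong refl) (auto simp: face_face add.commute)
  finally show ?case
    unfolding above by (simp add: case_prod_beta sum_negf del: minus_frag_cmul)
qed

text \<open>Faces \<open>k\<close> and \<open>k + 1\<close> cancel; the minus sign comes from the
  index shift in the faces above them. For \<open>k = 0\<close> the truncated \<open>k - 1\<close>
  is harmless because its sum is empty, and for \<open>k = Suc p\<close> the other sum is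
  empty.\<close>

lemma boundary_degeneracy:
  assumes "x \<in> X (Suc p)" "k \<le> Suc p"
  shows "boundary (Suc p) (frag_of (degeneracy (Suc p) k x)) =
    (\<Sum>j<k. frag_cmul ((-1) ^ j) (frag_of (degeneracy p (k - 1) (face p j x)))) -
    (\<Sum>j\<in>{k<..Suc p}. frag_cmul ((-1) ^ j) (frag_of (degeneracy p k (face p j x))))"
proof -
  let ?f = "\<lambda>j. frag_cmul ((-1) ^ j) (frag_of (face (Suc p) j (degeneracy (Suc p) k x)))"
  have "(\<Sum>j<k. ?f j) = (\<Sum>j<k. frag_cmul ((-1) ^ j) (frag_of (degeneracy p (k - 1) (face p j x))))"
  proof (rule sum.cong)
    fix j assume "j \<in> {..<k}"
    then show "?f j = frag_cmul ((-1) ^ j) (frag_of (degeneracy p (k - 1) (face p j x)))"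
      using assms face_degeneracy_below[of j "k - 1" p x] by simp
  qed simp
  moreover have "?f k + ?f (Suc k) = 0"
    using assms by (simp add: face_degeneracy_cancel flip: minus_frag_cmul)
  moreover have "(\<Sum>j\<in>{k<..Suc p}. ?f (Suc j))
      = (\<Sum>j\<in>{k<..Suc p}. - frag_cmul ((-1) ^ j) (frag_of (degeneracy p k (face p j x))))"
    using assms by (intro sum.cong) (auto simp: face_degeneracy_above)
  ultimately show ?thesis
    unfolding boundary_frag_of sum_atMost_split_two[OF assms(2)]
    by (simp add: sum_negf add.assoc del: minus_frag_cmul)
qed

section \<open>The degeneracy of index \<open>k\<close> as a chain homotopy\<close>

definition degeneracy_chain :: "nat \<Rightarrow> nat \<Rightarrow> ('a \<Rightarrow>\<^sub>0 int) \<Rightarrow> ('a \<Rightarrow>\<^sub>0 int)"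
  where "degeneracy_chain p k = frag_extend (\<lambda>x. frag_of (degeneracy p k x))"

lemma degeneracy_chain_frag_of: "degeneracy_chain p k (frag_of x) = frag_of (degeneracy p k x)"
  by (simp add: degeneracy_chain_def)

lemma degeneracy_chain_zero: "degeneracy_chain p k 0 = 0"
  and degeneracy_chain_diff:
    "degeneracy_chain p k (a - b) = degeneracy_chain p k a - degeneracy_chain p k b"
  by (simp_all add: degeneracy_chain_def frag_extend_diff)

text \<open>For \<open>k = p + 1\<close> the index of \<^term>\<open>degeneracy p k\<close> is out of range; both sides then contain the
  same meaningless terms.\<close>

lemma boundary_degeneracy_homotopy:
  assumes "x \<in> X (Suc p)" "k \<le> Suc p"
  shows "boundary (Suc p) (frag_of (degeneracy (Suc p) k x))
      + degeneracy_chain p k (boundary p (frag_of x)) =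
    (\<Sum>j<k. frag_cmul ((-1) ^ j) (frag_of (degeneracy p (k - 1) (face p j x)))) +
    (\<Sum>j\<le>k. frag_cmul ((-1) ^ j) (frag_of (degeneracy p k (face p j x))))"
proof -
  let ?g = "\<lambda>j. frag_cmul ((-1) ^ j) (frag_of (degeneracy p k (face p j x)))"
  have "degeneracy_chain p k (boundary p (frag_of x)) = (\<Sum>j\<le>Suc p. ?g j)"
    unfolding boundary_frag_of degeneracy_chain_def
    by (simp only: frag_extend_sum finite_atMost o_def frag_extend_cmul frag_extend_of)
  \<comment> \<open>The part above \<open>k\<close> cancels against the second sum of
    \<open>boundary_degeneracy\<close>.\<close>
  also have "{..Suc p} = {..k} \<union> {k<..Suc p}"
    using assms(2) by auto
  also have "sum ?g \<dots> = (\<Sum>j\<le>k. ?g j) + (\<Sum>j\<in>{k<..Suc p}. ?g j)"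
    by (rule sum.union_disjoint) auto
  finally show ?thesis
    by (simp add: boundary_degeneracy[OF assms])
qed

text \<open>Each filtration step is a subcomplex: by the boundary formula, only degeneracies of
  index \<open>i\<close> and \<open>i - 1\<close> occur in the boundary of one of index
  \<open>i\<close>.\<close>

lemma boundary_degeneracies:
  assumes "y \<in> degeneracies k (Suc p)"
  shows "Poly_Mapping.keys (boundary p (frag_of y)) \<subseteq> degeneracies k p"
proof -
  obtain i x where x: "i < k" "i \<le> p" "x \<in> X p" "y = degeneracy p i x"
    using assms by (rule degeneraciesE)
  show ?thesis
  proof (cases p)
    \<comment> \<open>The boundary formula starts one dimension higher; here the two faces of a
      degenerate edge coincide and cancel.\<close>
    case 0
    then show ?thesis
      using x by (simp add: boundary_frag_of face_degeneracy_cancel)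
  next
    case (Suc q)
    then show ?thesis
      using x unfolding x(4) Suc
      by (subst boundary_degeneracy; (intro keys_diff_subset keys_frag_sum_subset degeneraciesI face_closed)?)
        auto
  qed
qed

text \<open>For \<open>i < k\<close>, applying index \<open>k\<close> after index \<open>i\<close>
  equals applying \<open>i\<close> after \<open>k - 1\<close>, so the outer index stays below
  \<open>k\<close>.\<close>

lemma degeneracy_degeneracies:
  assumes "y \<in> degeneracies k (Suc p)" "k \<le> Suc p"
  shows "degeneracy (Suc p) k y \<in> degeneracies k (Suc (Suc p))"
proof -
  obtain i x where x: "i < k" "i \<le> p" "x \<in> X p" "y = degeneracy p i x"
    using assms(1) by (rule degeneraciesE)
  then have "degeneracy (Suc p) k y = degeneracy (Suc p) i (degeneracy p (k - 1) x)"
    using assms(2) degeneracy_degeneracy[of i "k - 1" p x] by simp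
  then show ?thesis
    using x assms(2) by (auto intro!: degeneraciesI degeneracy_closed)
qed

text \<open>In the homotopy formula the term \<open>j = k\<close> is \<open>y\<close> itself with
  sign \<open>(-1) ^ k\<close>, since face \<open>k\<close> of \<open>y\<close> is \<open>x\<close>.
  All remaining terms have \<open>j < k\<close> and can be written with outer index
  \<open>k - 1\<close>.\<close>

lemma homotopy_degeneracy:
  assumes "x \<in> X p" "k \<le> p" and y: "y = degeneracy p k x"
  shows "Poly_Mapping.keys (boundary (Suc p) (frag_of (degeneracy (Suc p) k y))
      + degeneracy_chain p k (boundary p (frag_of y)) - frag_cmul ((-1) ^ k) (frag_of y))
    \<subseteq> degeneracies k (Suc p)"
proof -
  have yX: "y \<in> X (Suc p)" using assms by (simp add: degeneracy_closed)
  have "degeneracy p k (face p j y) \<in> degeneracies k (Suc p)" if "j < k" for j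
  proof -
    obtain k' q where kq: "k = Suc k'" "p = Suc q"
      using \<open>j < k\<close> \<open>k \<le> p\<close> by (metis Suc_le_D not0_implies_Suc not_less_zero)
    then have "face p j y = degeneracy q k' (face q j x)"
      using assms that by (simp add: face_degeneracy_below)
    then have "degeneracy p k (face p j y) = degeneracy p k' (degeneracy q k' (face q j x))"
      using kq assms by (simp add: degeneracy_degeneracy face_closed)
    then show ?thesis
      using kq assms by (auto intro!: degeneraciesI degeneracy_closed face_closed)
  qed
  moreover have "degeneracy p (k - 1) (face p j y) \<in> degeneracies k (Suc p)" if "j < k" for j
    using that assms(2) yX by (intro degeneraciesI face_closed) auto
  moreover have "boundary (Suc p) (frag_of (degeneracy (Suc p) k y))
      + degeneracy_chain p k (boundary p (frag_of y)) - frag_cmul ((-1) ^ k) (frag_of y)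
    = (\<Sum>j<k. frag_cmul ((-1) ^ j) (frag_of (degeneracy p (k - 1) (face p j y)))) +
      (\<Sum>j<k. frag_cmul ((-1) ^ j) (frag_of (degeneracy p k (face p j y))))"
    using boundary_degeneracy_homotopy[OF yX, of k] assms
    by (simp add: face_degeneracy_cancel flip: lessThan_Suc_atMost)
  ultimately show ?thesis
    by (simp only:) (intro keys_add_subset keys_frag_sum_subset; simp)
qed

text \<open>By linearity it is enough to check generators. Those of index exactly \<open>k\<close>
  are the previous case; for those already in \<open>degeneracies k\<close> each of the three terms
  stays there separately.\<close>

lemma homotopy_degeneracies:
  assumes "Poly_Mapping.keys c \<subseteq> degeneracies (Suc k) (Suc p)" "k \<le> p"
  shows "Poly_Mapping.keys (boundary (Suc p) (degeneracy_chain (Suc p) k c)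
      + degeneracy_chain p k (boundary p c) - frag_cmul ((-1) ^ k) c)
    \<subseteq> degeneracies k (Suc p)" (is "Poly_Mapping.keys (?T c) \<subseteq> _")
  using assms(1)
proof (induction c rule: frag_induction)
  case zero
  then show ?case by (simp add: boundary_zero degeneracy_chain_zero)
next
  case (diff a b)
  have "?T (a - b) = ?T a - ?T b"
    by (simp add: boundary_diff degeneracy_chain_diff frag_cmul_diff)
  then show ?case using diff by (simp add: keys_diff_subset)
next
  case (one y)
  then obtain i x where x: "i < Suc k" "i \<le> p" "x \<in> X p" "y = degeneracy p i x"
    by (rule degeneraciesE)
  show ?case
  proof (cases "i = k")
    case True
    then show ?thesis
      using homotopy_degeneracy[of x p k y] x by (simp add: degeneracy_chain_frag_of)
  next
    case False
    then have y: "y \<in> degeneracies k (Suc p)"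
      using x by (auto intro: degeneraciesI)
    have "Poly_Mapping.keys (degeneracy_chain p k (boundary p (frag_of y))) \<subseteq> degeneracies k (Suc p)"
    proof (cases p)
      case 0
      then show ?thesis
        using boundary_degeneracies[OF y] by (simp add: degeneracies_0 degeneracy_chain_zero)
    next
      case (Suc q)
      then show ?thesis
        using boundary_degeneracies[OF y] assms(2) unfolding degeneracy_chain_def
        by (intro keys_frag_extend_subset) (auto simp: degeneracy_degeneracies)
    qed
    moreover have "Poly_Mapping.keys (boundary (Suc p) (degeneracy_chain (Suc p) k (frag_of y)))
        \<subseteq> degeneracies k (Suc p)"
      unfolding degeneracy_chain_frag_of
      using y assms(2) by (intro boundary_degeneracies degeneracy_degeneracies) auto
    ultimately show ?thesis
      using y by (intro keys_diff_subset keys_add_subset keys_cmul_subset) auto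
  qed
qed

text \<open>Induction over the filtration for all cycles at once, since the correction replaces
  \<open>c\<close> by another cycle one step lower.\<close>

lemma degeneracies_acyclic:
  assumes "Poly_Mapping.keys c \<subseteq> degeneracies k (Suc p)" "boundary p c = 0"
  shows "\<exists>e. Poly_Mapping.keys e \<subseteq> degeneracies k (Suc (Suc p)) \<and> boundary (Suc p) e = c"
  using assms
proof (induction k arbitrary: c)
  case 0
  then show ?case by (auto simp: degeneracies_0 boundary_zero)
next
  case (Suc k)
  have mono: "degeneracies k r \<subseteq> degeneracies (Suc k) r" for r
    by (fastforce simp: degeneracies_def)
  show ?case
  proof (cases "k \<le> p")
    case False
    \<comment> \<open>Beyond \<open>k = p\<close> no new index is available in this dimension, so
      the filtration step is unchanged.\<close>
    then have "degeneracies (Suc k) (Suc p) = degeneracies k (Suc p)"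
      by (fastforce simp: degeneracies_def)
    then obtain e where "Poly_Mapping.keys e \<subseteq> degeneracies k (Suc (Suc p))" "boundary (Suc p) e = c"
      using Suc.IH[of c] Suc.prems by auto
    then show ?thesis using mono[of "Suc (Suc p)"] by (metis order_trans)
  next
    case True
    let ?s = "frag_cmul ((-1) ^ k) (degeneracy_chain (Suc p) k c)"
    have c: "Poly_Mapping.keys c \<subseteq> X (Suc p)"
      using Suc.prems(1) degeneracies_subset by blast
    have s: "Poly_Mapping.keys ?s \<subseteq> degeneracies (Suc k) (Suc (Suc p))"
      unfolding degeneracy_chain_def using True c
      by (intro keys_cmul_subset keys_frag_extend_subset) (auto intro!: degeneraciesI)
    then have "Poly_Mapping.keys ?s \<subseteq> X (Suc (Suc p))"
      using degeneracies_subset by blast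
    then have "boundary p (c - boundary (Suc p) ?s) = 0"
      by (simp add: boundary_diff boundary_boundary Suc.prems(2))
    \<comment> \<open>As \<open>c\<close> is a cycle, the middle term of the homotopy vanishes, and
      \<open>(-1) ^ k\<close> squares to one.\<close>
    moreover have "c - boundary (Suc p) ?s = frag_cmul (- ((-1) ^ k))
        (boundary (Suc p) (degeneracy_chain (Suc p) k c)
          + degeneracy_chain p k (boundary p c) - frag_cmul ((-1) ^ k) c)"
      by (simp add: Suc.prems(2) degeneracy_chain_zero boundary_cmul poly_mapping_eq_iff fun_eq_iff
          lookup_minus lookup_add algebra_simps flip: power_mult_distrib)
    then have "Poly_Mapping.keys (c - boundary (Suc p) ?s) \<subseteq> degeneracies k (Suc p)"
      using homotopy_degeneracies[OF Suc.prems(1) True] keys_cmul_subset by metis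
    ultimately obtain e where e: "Poly_Mapping.keys e \<subseteq> degeneracies k (Suc (Suc p))"
      "boundary (Suc p) e = c - boundary (Suc p) ?s"
      using Suc.IH by blast
    then have "boundary (Suc p) (e + ?s) = c"
      by (simp add: boundary_add)
    moreover have "Poly_Mapping.keys (e + ?s) \<subseteq> degeneracies (Suc k) (Suc (Suc p))"
      using e(1) s mono by (intro keys_add_subset) blast+
    ultimately show ?thesis by blast
  qed
qed

section \<open>Degenerate chains as an acyclic subcomplex\<close>

lemma degenerate_chains_eq: "degenerate_chains p = {c. Poly_Mapping.keys c \<subseteq> degeneracies p p}"
  by (simp add: degenerate_chains_def chains_def degenerate_eq_degeneracies generate_frag_of
      degeneracies_subset)

text \<open>The filtration is already exhausted at \<open>k = p\<close> in dimension
  \<open>p\<close>. This allows one fixed \<open>k\<close> to describe the degenerate chains in two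
  neighbouring degrees.\<close>

lemma degeneracies_Suc: "degeneracies (Suc p) p = degeneracies p p"
  by (fastforce simp: degeneracies_def)

lemma chain_complex_chains: "chain_complex chains boundary"
proof (rule chain_complex.intro)
  fix p
  show "comm_group (chains p)"
    by (simp add: chains_def abelian_free_Abelian_group)
  show "boundary p \<in> hom (chains (Suc p)) (chains p)"
    by (rule homI) (simp_all add: chains_def boundary_closed boundary_add)
  fix c assume "c \<in> carrier (chains (Suc (Suc p)))"
  then show "boundary p (boundary (Suc p) c) = \<one>\<^bsub>chains p\<^esub>"
    by (simp add: chains_def boundary_boundary)
qed

lemma subgroup_degenerate_chains: "subgroup (degenerate_chains p) (chains p)"
  unfolding degenerate_chains_eq chains_def
  by (rule subgroup_free_Abelian_group[OF degeneracies_subset])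

lemma boundary_degenerate_chains: "boundary p ` degenerate_chains (Suc p) \<subseteq> degenerate_chains p"
proof -
  have "Poly_Mapping.keys (boundary p c) \<subseteq> degeneracies (Suc p) p"
    if "Poly_Mapping.keys c \<subseteq> degeneracies (Suc p) (Suc p)" for c
    using that boundary_degeneracies[of _ "Suc p" p] unfolding boundary_def
    by (intro keys_frag_extend_subset) (auto simp del: sum.atMost_Suc)
  then show ?thesis by (auto simp: degenerate_chains_eq degeneracies_Suc)
qed

lemma degenerate_chains_acyclic:
  assumes "c \<in> degenerate_chains p" "c \<in> cycles chains boundary p"
  shows "c \<in> boundary p ` degenerate_chains (Suc p)"
proof (cases p)
  case 0
  then have "c = boundary p 0"
    using assms(1) by (simp add: degenerate_chains_eq degeneracies_0 boundary_zero)
  then show ?thesis by (rule image_eqI) (simp add: degenerate_chains_eq)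
next
  case (Suc q)
  \<comment> \<open>Choosing \<open>k = Suc (Suc q)\<close> makes the bounding chain range over all
    degenerate simplices one dimension up.\<close>
  then have "Poly_Mapping.keys c \<subseteq> degeneracies (Suc (Suc q)) (Suc q)" "boundary q c = 0"
    using assms by (auto simp: degenerate_chains_eq degeneracies_Suc cycles_def kernel_def chains_def)
  from degeneracies_acyclic[OF this] show ?thesis
    using Suc by (auto simp: degenerate_chains_eq)
qed

end

theorem theorem24:
  fixes X :: "nat \<Rightarrow> 'a set"
    and act :: "nat \<Rightarrow> nat \<Rightarrow> (nat \<Rightarrow> nat) \<Rightarrow> 'a \<Rightarrow> 'a"
  assumes "simplicial_set X act"
  shows "homology_equivalence
    (simplicial_set.chains X) (simplicial_set.boundary act)
    (simplicial_set.normalized_chains X act) (simplicial_set.normalized_boundary X act)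
    (simplicial_set.normalization X act)"
proof -
  interpret simplicial_set X act by fact
  \<comment> \<open>The projection to normalized chains is the general quotient construction with
    \<open>degenerate_chains\<close> as the subcomplex.\<close>
  have eqs: "normalized_chains = (\<lambda>p. chains p Mod degenerate_chains p)"
    "normalized_boundary = (\<lambda>p. coset_map (chains p) (degenerate_chains p) (boundary p))"
    "normalization = (\<lambda>p c. degenerate_chains p #>\<^bsub>chains p\<^esub> c)"
    by (simp_all add: fun_eq_iff normalized_chains_def normalized_boundary_def normalization_def)
  show ?thesis
    unfolding eqs
    using chain_complex.quotient_homology_equivalence[OF chain_complex_chains
        subgroup_degenerate_chains boundary_degenerate_chains degenerate_chains_acyclic] .
qed

end
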